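(* Let $n\ge 1$ be an integer. The factorial posets on $[n]$ are in bijection with the inversion tables of length $n$, and thus the number of factorial posets on $[n]$ is $n!$.
   Context: $[n]=\{1,\dots,n\}$. A poset $P$ on $[n]$ (with strict order $<_P$) is naturally labeled if $i<_P j$ implies $i<j$ in the usual order of integers. A factorial poset on $[n]$ is a naturally labeled poset $P$ on $[n]$ such that for all $i,j,k\in[n]$: if $i<j$ (usual order) and $j<_P k$, then $i<_P k$. Posets are counted as labeled objects (i.e. as order relations on $[n]$, not up to isomorphism). An inversion table of length $n$ is an integer sequence $(a_1,\dots,a_n)$ with $0\le a_i\le i-1$ for all $i$. *)

theory Defs
  imports Main "HOL-Library.FuncSet"
begin

(* A poset on [n] is given by its reflexive order relation r, with
   partial_order_on {1..n} r; in particular r is a subset of {1..n} \<times> {1..n}, so distinct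
   relations are distinct labeled posets. *)

definition strict_less :: "nat rel \<Rightarrow> nat \<Rightarrow> nat \<Rightarrow> bool" where
  "strict_less r i j \<longleftrightarrow> (i, j) \<in> r \<and> i \<noteq> j"

definition naturally_labeled :: "nat \<Rightarrow> nat rel \<Rightarrow> bool" where
  "naturally_labeled n r \<longleftrightarrow>
     (\<forall>i\<in>{1..n}. \<forall>j\<in>{1..n}. strict_less r i j \<longrightarrow> i < j)"

definition factorial_poset :: "nat \<Rightarrow> nat rel \<Rightarrow> bool" where
  "factorial_poset n r \<longleftrightarrow>
     partial_order_on {1..n} r \<and> naturally_labeled n r \<and>
     (\<forall>i\<in>{1..n}. \<forall>j\<in>{1..n}. \<forall>k\<in>{1..n}.
        i < j \<and> strict_less r j k \<longrightarrow> strict_less r i k)"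

(* A sequence (a_1, ..., a_n) is a function on {1..n}. The extensional function space fixes
   the irrelevant values outside {1..n}, so that equal sequences are equal functions. *)

definition inversion_tables :: "nat \<Rightarrow> (nat \<Rightarrow> int) set" where
  "inversion_tables n = (\<Pi>\<^sub>E i\<in>{1..n}. {0..int i - 1})"

end

theory Submission
  imports Defs
begin

text \<open>
  In a factorial poset the strict predecessors of \<open>k\<close> form an initial segment of the
  positive integers, because everything below (as an integer) a predecessor of \<open>k\<close> is itself a
  predecessor of \<open>k\<close>. Such a segment is determined by its size \<open>a\<^sub>k\<close>, so the
  poset is determined by the sequence of these sizes, and \<open>a\<^sub>k \<le> k - 1\<close> since
  the segment does not contain \<open>k\<close>.

  Conversely every inversion table arises: put \<open>i\<close> strictly below \<open>k\<close> exactly when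
  \<open>1 \<le> i \<le> a\<^sub>k\<close>. The bound \<open>a\<^sub>k < k\<close> makes this naturally labeled, hence antisymmetric,
  and it also gives transitivity: from \<open>i \<le> a\<^sub>j\<close> and \<open>j \<le> a\<^sub>k\<close> follows
  \<open>i \<le> a\<^sub>j < j \<le> a\<^sub>k\<close>. So \<open>predecessor_counts\<close> and \<open>table_poset\<close> are
  mutually inverse; the segment property behind this is \<open>strict_less_iff_le_card\<close>. The count is
  the product over \<open>k\<close> of the \<open>k\<close> possible values of \<open>a\<^sub>k\<close>.
\<close>

definition predecessor_counts :: "nat \<Rightarrow> nat rel \<Rightarrow> nat \<Rightarrow> int" where
  "predecessor_counts n r = (\<lambda>k\<in>{1..n}. int (card {i. strict_less r i k}))"

definition table_poset :: "nat \<Rightarrow> (nat \<Rightarrow> int) \<Rightarrow> nat rel" where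
  "table_poset n a = {(i, k). i \<in> {1..n} \<and> k \<in> {1..n} \<and> (i = k \<or> int i \<le> a k)}"

lemma down_closed_eq_atLeastAtMost_card:
  fixes D :: "nat set"
  assumes fin: "finite D" and pos: "0 \<notin> D"
    and down: "\<And>i j. j \<in> D \<Longrightarrow> 1 \<le> i \<Longrightarrow> i < j \<Longrightarrow> i \<in> D"
  shows "D = {1..card D}"
proof (cases "D = {}")
  case False
  have eq: "D = {1..Max D}"
  proof
    show "D \<subseteq> {1..Max D}"
      using fin pos by (auto simp: Suc_le_eq intro: gr0I)
    show "{1..Max D} \<subseteq> D"
      using down[OF Max_in[OF fin False]] Max_in[OF fin False] by (auto simp: le_less)
  qed
  from arg_cong[OF eq, of card] have "card D = Max D"
    by simp
  with eq show ?thesis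
    by argo
qed simp

text \<open>The factorial condition says precisely that the strict predecessors of \<open>k\<close> are closed
  downwards in the usual order of \<open>{1..n}\<close>. Hence they form an initial segment, and their number
  alone recovers them; this makes \<open>predecessor_counts\<close> injective.\<close>

lemma strict_less_iff_le_card:
  assumes P: "factorial_poset n r" and k: "k \<in> {1..n}"
  shows "strict_less r i k \<longleftrightarrow> 1 \<le> i \<and> i \<le> card {i. strict_less r i k}"
proof -
  let ?D = "{i. strict_less r i k}"
  have field: "r \<subseteq> {1..n} \<times> {1..n}"
    using P by (auto simp: factorial_poset_def partial_order_on_def preorder_on_def refl_on_def)
  then have D: "?D \<subseteq> {1..n}"
    by (auto simp: strict_less_def)
  have "?D = {1..card ?D}"
  proof (rule down_closed_eq_atLeastAtMost_card)
    show "finite ?D"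
      using D finite_subset by blast
    show "0 \<notin> ?D"
      using D by auto
    show "i \<in> ?D" if "j \<in> ?D" "1 \<le> i" "i < j" for i j
    proof -
      have "j \<in> {1..n}" "i \<in> {1..n}"
        using that D by auto
      then show ?thesis
        using P k that unfolding factorial_poset_def by blast
    qed
  qed
  then have "i \<in> ?D \<longleftrightarrow> i \<in> {1..card ?D}"
    by (rule arg_cong)
  then show ?thesis
    unfolding mem_Collect_eq atLeastAtMost_iff .
qed

lemma predecessor_counts_in_inversion_tables:
  assumes P: "factorial_poset n r"
  shows "predecessor_counts n r \<in> inversion_tables n"
proof -
  have "int (card {i. strict_less r i k}) \<in> {0..int k - 1}" if k: "k \<in> {1..n}" for k
  proof -
    \<comment> \<open>An initial segment that misses \<open>k\<close> stays below \<open>k\<close>.\<close>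
    have "\<not> strict_less r k k"
      by (simp add: strict_less_def)
    then have "card {i. strict_less r i k} < k"
      using strict_less_iff_le_card[OF P k, of k] k by auto
    then show ?thesis by auto
  qed
  then show ?thesis
    unfolding inversion_tables_def predecessor_counts_def by auto
qed

lemma table_poset_predecessor_counts:
  assumes P: "factorial_poset n r"
  shows "table_poset n (predecessor_counts n r) = r"
proof -
  have field: "r \<subseteq> {1..n} \<times> {1..n}" and refl: "\<And>i. i \<in> {1..n} \<Longrightarrow> (i, i) \<in> r"
    using P by (auto simp: factorial_poset_def partial_order_on_def preorder_on_def refl_on_def)
  have "(i, k) \<in> r \<longleftrightarrow> i = k \<or> int i \<le> predecessor_counts n r k"
    if "i \<in> {1..n}" "k \<in> {1..n}" for i k
    using strict_less_iff_le_card[OF P that(2), of i] refl that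
    by (auto simp: strict_less_def predecessor_counts_def)
  then show ?thesis
    using field unfolding table_poset_def by auto
qed

lemma inversion_tables_bounds:
  assumes "a \<in> inversion_tables n" and "k \<in> {1..n}"
  shows "0 \<le> a k" and "a k < int k"
  using PiE_mem[OF assms(1)[unfolded inversion_tables_def] assms(2)] by simp_all

lemma strict_less_table_poset_iff:
  assumes a: "a \<in> inversion_tables n" and k: "k \<in> {1..n}"
  shows "strict_less (table_poset n a) i k \<longleftrightarrow> 1 \<le> i \<and> int i \<le> a k"
  using inversion_tables_bounds[OF a k] k
  by (auto simp: strict_less_def table_poset_def)

lemma factorial_poset_table_poset:
  assumes a: "a \<in> inversion_tables n"
  shows "factorial_poset n (table_poset n a)"
proof -
  have less: "i < k" if "k \<in> {1..n}" "int i \<le> a k" for i k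
    using inversion_tables_bounds[OF a that(1)] that(2) by simp
  have "trans (table_poset n a)"
  proof (rule transI)
    fix i j k
    assume "(i, j) \<in> table_poset n a" "(j, k) \<in> table_poset n a"
    then show "(i, k) \<in> table_poset n a"
      using less[of j i] by (auto simp: table_poset_def)
  qed
  moreover have "antisym (table_poset n a)"
  proof (rule antisymI)
    fix i k
    assume "(i, k) \<in> table_poset n a" "(k, i) \<in> table_poset n a"
    then show "i = k"
      using less[of k i] less[of i k] by (auto simp: table_poset_def)
  qed
  moreover have "refl_on {1..n} (table_poset n a)" "table_poset n a \<subseteq> {1..n} \<times> {1..n}"
    by (auto simp: refl_on_def table_poset_def)
  ultimately have "partial_order_on {1..n} (table_poset n a)"
    by (simp add: partial_order_on_def preorder_on_def)
  then show ?thesis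
    using less unfolding factorial_poset_def naturally_labeled_def
    by (auto simp: strict_less_table_poset_iff[OF a])
qed

lemma predecessor_counts_table_poset:
  assumes a: "a \<in> inversion_tables n"
  shows "predecessor_counts n (table_poset n a) = a"
proof
  fix k
  show "predecessor_counts n (table_poset n a) k = a k"
  proof (cases "k \<in> {1..n}")
    case True
    have "{i. strict_less (table_poset n a) i k} = {1..nat (a k)}"
      by (simp add: set_eq_iff strict_less_table_poset_iff[OF a True] le_nat_iff
          inversion_tables_bounds(1)[OF a True])
    then show ?thesis
      using True inversion_tables_bounds[OF a True] by (simp add: predecessor_counts_def)
  next
    case False
    \<comment> \<open>Outside the index set both sides take the value \<open>undefined\<close>.\<close>
    then show ?thesis
      using PiE_arb[OF a[unfolded inversion_tables_def] False]
      by (simp add: predecessor_counts_def del: atLeastAtMost_iff)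
  qed
qed

lemma bij_betw_predecessor_counts:
  "bij_betw (predecessor_counts n) {r. factorial_poset n r} (inversion_tables n)"
  by (rule bij_betw_byWitness[where f' = "table_poset n"])
    (auto simp: table_poset_predecessor_counts predecessor_counts_table_poset
      predecessor_counts_in_inversion_tables factorial_poset_table_poset)

lemma card_inversion_tables: "card (inversion_tables n) = fact n"
  by (simp add: inversion_tables_def card_PiE fact_prod)

theorem theorem5:
  fixes n :: nat
  assumes "n \<ge> 1"
  shows "(\<exists>f. bij_betw f {r. factorial_poset n r} (inversion_tables n)) \<and>
         card {r. factorial_poset n r} = fact n"
  using bij_betw_predecessor_counts[of n] bij_betw_same_card card_inversion_tables[of n]
  by metis

end
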